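(* Let $T$ be a Lyndon word with Lyndon SLP $\mathcal{G}$. For every pattern $P$ of length $m$, the number of partition pairs of $P$ (with respect to $\mathcal{G}$) is $O(\lg m)$.
   Context: A string is a Lyndon word if it is lexicographically strictly smaller than each of its non-empty proper suffixes. The standard factorization of a Lyndon word $w$, $|w|\ge2$, is $(u,v)$ with $w=uv$ and $v$ the longest proper suffix of $w$ that is Lyndon. The Lyndon SLP of a Lyndon word $T$ is the straight-line program (rules $X_i\to a$, $a\in\Sigma$, or $X_i \to X_\ell X_r$ with $\ell,r<i$; $\mathit{val}(X)$ the derived string; start symbol derives $T$) such that every $\mathit{val}(X_i)$ is Lyndon, every rule $X_i\to X_\ell X_r$ satisfies that $(\mathit{val}(X_\ell),\mathit{val}(X_r))$ is the standard factorization of $\mathit{val}(X_i)$, and distinct variables derive distinct strings. A partition pair (at position $i$) of $P[1..m]$ is a pair $(P[1..i],P[i+1..m])$ with $i\in[1..m]$ such that there is a rule $X_j\to X_\ell X_r$ of the Lyndon SLP with $P[1..i]$ a (not necessarily proper) suffix of $\mathit{val}(X_\ell)$ and $P[i+1..m]$ a (not necessarily proper) prefix of $\mathit{val}(X_r)$. *)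

theory Defs
  imports
    "HOL-Library.List_Lexorder"
    "HOL-Library.Sublist"
    "HOL-Library.Landau_Symbols"
begin

text \<open>The order \<open><\<close> on lists is the strict lexicographic order of \<open>HOL-Library.List_Lexorder\<close>
  (a proper prefix is smaller).  Words are non-empty.\<close>

definition lyndon :: "'a::linorder list \<Rightarrow> bool" where
  "lyndon w \<longleftrightarrow> w \<noteq> [] \<and> (\<forall>s. s \<noteq> [] \<and> strict_suffix s w \<longrightarrow> w < s)"

definition standard_factorization ::
    "'a::linorder list \<Rightarrow> 'a list \<Rightarrow> 'a list \<Rightarrow> bool" where
  "standard_factorization w u v \<longleftrightarrow>
     lyndon w \<and> 2 \<le> length w \<and> w = u @ v \<and>
     strict_suffix v w \<and> lyndon v \<and>
     (\<forall>v'. strict_suffix v' w \<and> lyndon v' \<longrightarrow> length v' \<le> length v)"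

datatype 'a rule = Letter 'a | Concat nat nat

text \<open>The variables are the positions of the list \<open>rules G\<close>; variable \<open>i\<close> has the
  right-hand side \<open>rules G ! i\<close>.\<close>

record 'a slp =
  rules :: "'a rule list"
  start :: nat

definition slp :: "'a slp \<Rightarrow> bool" where
  "slp G \<longleftrightarrow> start G < length (rules G) \<and>
     (\<forall>i<length (rules G). \<forall>l r. rules G ! i = Concat l r \<longrightarrow> l < i \<and> r < i)"

text \<open>The guards only ensure termination; the default \<open>[]\<close> is never reached from a
  variable of a grammar satisfying \<open>slp\<close>.\<close>

fun rule_val :: "'a rule list \<Rightarrow> nat \<Rightarrow> 'a list" where
  "rule_val R i =
     (if i < length R then
        (case R ! i of
           Letter a \<Rightarrow> [a]
         | Concat l r \<Rightarrow> if l < i \<and> r < i then rule_val R l @ rule_val R r else [])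
      else [])"

declare rule_val.simps [simp del]

definition val :: "'a slp \<Rightarrow> nat \<Rightarrow> 'a list" where
  "val G i = rule_val (rules G) i"

lemma val_Letter:
  assumes "i < length (rules G)" "rules G ! i = Letter a"
  shows "val G i = [a]"
  using assms by (simp add: val_def rule_val.simps[of _ i])

lemma val_Concat:
  assumes "slp G" "i < length (rules G)" "rules G ! i = Concat l r"
  shows "val G i = val G l @ val G r"
  using assms by (simp add: val_def slp_def rule_val.simps[of _ i])

definition lyndon_slp :: "'a::linorder slp \<Rightarrow> 'a list \<Rightarrow> bool" where
  "lyndon_slp G T \<longleftrightarrow>
     slp G \<and> val G (start G) = T \<and>
     (\<forall>i<length (rules G). lyndon (val G i)) \<and>
     (\<forall>i<length (rules G). \<forall>l r. rules G ! i = Concat l r \<longrightarrow>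
        standard_factorization (val G i) (val G l) (val G r)) \<and>
     inj_on (val G) {..<length (rules G)}"

definition partition_pairs :: "'a slp \<Rightarrow> 'a list \<Rightarrow> ('a list \<times> 'a list) set" where
  "partition_pairs G P =
     {(take i P, drop i P) | i. i \<in> {1..length P} \<and>
        (\<exists>j<length (rules G). \<exists>l r. rules G ! j = Concat l r \<and>
           suffix (take i P) (val G l) \<and> prefix (drop i P) (val G r))}"

lemma finite_partition_pairs: "finite (partition_pairs G P)"
proof -
  have "partition_pairs G P \<subseteq> (\<lambda>i. (take i P, drop i P)) ` {1..length P}"
    by (auto simp: partition_pairs_def)
  then show ?thesis
    by (rule finite_subset) simp
qed

end

theory Submission
  imports Defs
begin

text \<open>
  The right factor \<open>v\<close> of the standard factorization of \<open>w\<close> is the least non-empty proper suffix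
  of \<open>w\<close>. Hence, if \<open>(x, y)\<close> is a partition pair of \<open>P\<close> with \<open>y\<close> non-empty and \<open>v = y z\<close>, then
  \<open>y z\<close> is least among all \<open>s z\<close>, where \<open>s\<close> ranges over the non-empty proper suffixes of \<open>P\<close>:
  \<open>y\<close> is a \<^emph>\<open>significant\<close> suffix of \<open>tl P\<close>. Of two significant suffixes \<open>y\<^sub>2\<close>, \<open>y\<^sub>1\<close> with
  \<open>|y\<^sub>2| < |y\<^sub>1|\<close>, the shorter is a border of the longer. If \<open>|y\<^sub>1| < 2 |y\<^sub>2|\<close>, this gives
  \<open>y\<^sub>1 = a y\<^sub>2\<close> and \<open>y\<^sub>2 = a y\<^sub>3\<close> with \<open>y\<^sub>3\<close> non-empty; cancelling \<open>a\<close> in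
  \<open>y\<^sub>2 z\<^sub>2 < y\<^sub>1 z\<^sub>2\<close> yields \<open>y\<^sub>3 z\<^sub>2 < y\<^sub>2 z\<^sub>2\<close>, a contradiction. So the lengths of
  significant suffixes at least double.
\<close>

lemma append_le_append_cancel [simp]:
  fixes x y :: "'a::linorder list"
  shows "a @ x \<le> a @ y \<longleftrightarrow> x \<le> y"
  by (induction a) auto

text \<open>While \<open>x\<close> lasts, the two inequalities bound its first letter against that
  of \<open>y\<close> from both sides, so the letters agree and cancel; the tails \<open>s\<close>
  and \<open>t\<close> may therefore differ.\<close>

lemma prefix_if_append_le_append:
  fixes x y :: "'a::linorder list"
  assumes "x @ s \<le> y @ s" "y @ t \<le> x @ t" "length x \<le> length y"
  shows "prefix x y"
  using assms
proof (induction x arbitrary: y)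
  case Nil
  then show ?case by simp
next
  case (Cons c x)
  then obtain d y' where "y = d # y'"
    by (cases y) auto
  with Cons show ?case by auto
qed

text \<open>The least non-empty proper suffix \<open>Min S\<close> is Lyndon, because its own
  suffixes lie in \<open>S\<close>. Maximality of \<open>v\<close> makes it a suffix of
  \<open>v\<close>, and \<open>v\<close>, being Lyndon, is at most each of its non-empty
  suffixes.\<close>

lemma standard_factorization_right_least:
  assumes sf: "standard_factorization w u v"
    and s: "strict_suffix s w" "s \<noteq> []"
  shows "v \<le> s"
proof -
  define S where "S = {t. strict_suffix t w \<and> t \<noteq> []}"
  have "finite S"
    unfolding S_def
    by (rule finite_subset[of _ "set (suffixes w)"]) (auto simp: strict_suffix_def)
  moreover have "s \<in> S"
    using s by (simp add: S_def)
  ultimately have min: "Min S \<in> S" "\<And>t. t \<in> S \<Longrightarrow> Min S \<le> t"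
    by (auto intro: Min_in)
  have "lyndon (Min S)"
    unfolding lyndon_def
  proof (intro conjI allI impI)
    show "Min S \<noteq> []"
      using min(1) by (simp add: S_def)
    fix t assume t: "t \<noteq> [] \<and> strict_suffix t (Min S)"
    then have "t \<in> S"
      using min(1) by (auto simp: S_def intro: suffix_order.less_trans)
    moreover have "t \<noteq> Min S"
      using t by auto
    ultimately show "Min S < t"
      using min(2) by (simp add: order.strict_iff_order)
  qed
  then have "length (Min S) \<le> length v"
    using sf min(1) by (auto simp: standard_factorization_def S_def)
  moreover have "suffix (Min S) w" "suffix v w"
    using sf min(1) by (auto simp: standard_factorization_def S_def strict_suffix_def)
  ultimately have "suffix (Min S) v"
    using suffix_length_suffix by blast
  then have "v \<le> Min S"
    using sf min(1)
    by (cases "Min S = v") (auto simp: standard_factorization_def lyndon_def S_def strict_suffix_def)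
  also have "\<dots> \<le> s"
    using min(2) \<open>s \<in> S\<close> .
  finally show ?thesis .
qed

text \<open>The continuation \<open>z\<close> may depend on \<open>y\<close>, since each rule
  extends \<open>P\<close> in its own way.\<close>

definition significant_suffix :: "'a::linorder list \<Rightarrow> 'a list \<Rightarrow> bool" where
  "significant_suffix Q y \<longleftrightarrow> suffix y Q \<and> y \<noteq> [] \<and>
     (\<exists>z. \<forall>s. suffix s Q \<longrightarrow> s \<noteq> [] \<longrightarrow> y @ z \<le> s @ z)"

lemma significant_suffix_length_double:
  assumes y1: "significant_suffix Q y1" and y2: "significant_suffix Q y2"
    and less: "length y2 < length y1"
  shows "2 * length y2 \<le> length y1"
proof (rule ccontr)
  assume "\<not> 2 * length y2 \<le> length y1"
  then have short: "length y1 < 2 * length y2" by simp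
  have suf: "suffix y1 Q" "suffix y2 Q" and ne: "y1 \<noteq> []" "y2 \<noteq> []"
    using y1 y2 by (auto simp: significant_suffix_def)
  obtain z1 where z1: "\<And>s. suffix s Q \<Longrightarrow> s \<noteq> [] \<Longrightarrow> y1 @ z1 \<le> s @ z1"
    using y1 by (auto simp: significant_suffix_def)
  obtain z2 where z2: "\<And>s. suffix s Q \<Longrightarrow> s \<noteq> [] \<Longrightarrow> y2 @ z2 \<le> s @ z2"
    using y2 by (auto simp: significant_suffix_def)
  have "prefix y2 y1"
    using prefix_if_append_le_append z1 z2 suf ne less by (meson less_imp_le)
  have "suffix y2 y1"
    using suf less suffix_length_suffix by (meson less_imp_le)
  then obtain a where a: "y1 = a @ y2"
    by (auto simp: suffix_def)
  have len_a: "0 < length a" "length a < length y2"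
    using a less short by auto
  then have "prefix a y2"
    using \<open>prefix y2 y1\<close> a prefix_length_prefix[of a y1 y2] by simp
  then obtain y3 where y3: "y2 = a @ y3"
    by (auto simp: prefix_def)
  have "y3 \<noteq> []"
    using y3 len_a by auto
  have "suffix y3 Q"
    using suf(2) y3 by (auto simp: suffix_def)
  have "y2 @ z2 \<le> y1 @ z2"
    using z2 suf ne by blast
  then have "y3 @ z2 \<le> y2 @ z2"
    using a y3 by simp
  moreover have "y2 @ z2 \<le> y3 @ z2"
    using z2 \<open>suffix y3 Q\<close> \<open>y3 \<noteq> []\<close> by blast
  ultimately have "y2 @ z2 = y3 @ z2"
    by (rule order.antisym[rotated])
  then show False
    using y3 len_a by simp
qed

lemma power_card_le_if_doubling:
  fixes A :: "nat set"
  assumes "finite A" "\<And>a. a \<in> A \<Longrightarrow> 1 \<le> a \<and> a \<le> m" "1 \<le> m"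
    and "\<And>a b. a \<in> A \<Longrightarrow> b \<in> A \<Longrightarrow> a < b \<Longrightarrow> 2 * a \<le> b"
  shows "2 ^ card A \<le> 2 * m"
  using assms
proof (induction A arbitrary: m rule: finite_linorder_max_induct)
  case empty
  then show ?case by simp
next
  case (insert b A)
  \<comment> \<open>Below the maximum \<open>b\<close> everything is at most \<open>b div 2\<close>,
    the bound to which the induction hypothesis is applied.\<close>
  have half: "1 \<le> a \<and> a \<le> b div 2" if "a \<in> A" for a
    using insert.prems(1,3) insert.hyps(2) that by fastforce
  have "2 ^ card A \<le> b"
  proof (cases "A = {}")
    case True
    then show ?thesis using insert.prems(1) by simp
  next
    case False
    then have "1 \<le> b div 2" using half by fastforce
    then have "2 ^ card A \<le> 2 * (b div 2)"
      using insert.IH half insert.prems(3) by blast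
    then show ?thesis by simp
  qed
  moreover have "b \<notin> A" "b \<le> m"
    using insert.hyps insert.prems(1) by auto
  ultimately show ?case
    using insert.hyps(1) by simp
qed

lemma partition_pair_significant_suffix:
  assumes G: "lyndon_slp G T" and xy: "(x, y) \<in> partition_pairs G P" and "y \<noteq> []"
  shows "significant_suffix (tl P) y"
proof -
  obtain i j l r where i: "1 \<le> i" and y: "y = drop i P"
    and j: "j < length (rules G)" "rules G ! j = Concat l r"
    and sufx: "suffix (take i P) (val G l)" and prefy: "prefix y (val G r)"
    using xy by (auto simp: partition_pairs_def)
  have sf: "standard_factorization (val G j) (val G l) (val G r)"
    using G j by (auto simp: lyndon_slp_def)
  obtain a z where a: "val G l = a @ take i P" and z: "val G r = y @ z"
    using sufx prefy by (auto simp: suffix_def prefix_def)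
  have w: "val G j = a @ P @ z"
    using sf a z y by (simp add: standard_factorization_def)
  obtain c P' where P: "P = c # P'"
    using \<open>y \<noteq> []\<close> y by (cases P) auto
  have "y @ z \<le> s @ z" if s: "suffix s (tl P)" "s \<noteq> []" for s
  proof -
    \<comment> \<open>Dropping the first letter of \<open>P\<close> keeps this suffix proper even if
      \<open>a\<close> is empty.\<close>
    have "strict_suffix (s @ z) (val G j)"
      using s(1) P w by (auto simp: strict_suffix_def suffix_def)
    then show ?thesis
      using standard_factorization_right_least[OF sf] s(2) z by simp
  qed
  moreover have "suffix y (tl P)"
    using i P y by (cases i) (auto simp: suffix_drop)
  ultimately show ?thesis
    using \<open>y \<noteq> []\<close> by (auto simp: significant_suffix_def)
qed

lemma card_partition_pairs_le:
  assumes G: "lyndon_slp G T"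
  shows "real (card (partition_pairs G P)) \<le> 2 + log 2 (real (length P))"
proof (cases "P = []")
  case True
  then have "partition_pairs G P = {}"
    by (auto simp: partition_pairs_def)
  \<comment> \<open>junk value: \<open>log 2 0 = 0\<close>\<close>
  then show ?thesis using True by (simp add: log_def)
next
  case False
  define L where "L = length ` {y. significant_suffix (tl P) y}"
  have bounds: "1 \<le> n \<and> n \<le> length P" if "n \<in> L" for n
    using that by (auto simp: L_def significant_suffix_def Suc_le_eq dest!: suffix_length_le)
  then have "finite L"
    by (meson finite_nat_set_iff_bounded_le)
  have inj: "inj_on (length \<circ> snd) (partition_pairs G P)"
    by (auto simp: inj_on_def partition_pairs_def) (metis diff_diff_cancel)+
  \<comment> \<open>The extra \<open>0\<close> accounts for the pair \<open>(P, [])\<close>.\<close>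
  have "(length \<circ> snd) ` partition_pairs G P \<subseteq> insert 0 L"
    using partition_pair_significant_suffix[OF G] by (fastforce simp: L_def)
  then have "card (partition_pairs G P) \<le> card (insert 0 L)"
    using inj \<open>finite L\<close> by (metis card_image card_mono finite_insert)
  also have "\<dots> \<le> Suc (card L)"
    by (rule card_insert_le_m1) auto
  finally have card: "card (partition_pairs G P) \<le> Suc (card L)" .
  have "2 ^ card L \<le> 2 * length P"
  proof (rule power_card_le_if_doubling)
    show "1 \<le> length P" using False by (simp add: Suc_le_eq)
    show "2 * a \<le> b" if "a \<in> L" "b \<in> L" "a < b" for a b
      using that significant_suffix_length_double by (auto simp: L_def)
  qed (use bounds \<open>finite L\<close> in auto)
  then have "2 ^ card L \<le> 2 * real (length P)"
    by (metis of_nat_le_iff of_nat_mult of_nat_numeral of_nat_power)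
  then have "real (card L) \<le> log 2 (2 * real (length P))"
    using False by (intro le_log_of_power) auto
  also have "\<dots> = 1 + log 2 (real (length P))"
    using False by (simp add: log_mult)
  finally show ?thesis using card by linarith
qed

theorem theorem1:
  "\<exists>f :: nat \<Rightarrow> real. f \<in> O(\<lambda>m. log 2 (real m)) \<and>
     (\<forall>(T :: 'a::linorder list) G P. lyndon T \<longrightarrow> lyndon_slp G T \<longrightarrow>
        real (card (partition_pairs G P)) \<le> f (length P))"
proof (intro exI conjI allI impI)
  show "(\<lambda>m. 2 + log 2 (real m)) \<in> O(\<lambda>m. log 2 (real m))"
  \<comment> \<open>From \<open>m = 2\<close> on the logarithm is at least 1, so the summand 2 costs
    at most two more logarithms.\<close>
  proof (rule bigoI[of _ 3], rule eventually_sequentiallyI[of 2])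
    fix m :: nat assume "2 \<le> m"
    then have "1 \<le> log 2 (real m)" by simp
    then show "norm (2 + log 2 (real m)) \<le> 3 * norm (log 2 (real m))" by simp
  qed
qed (rule card_partition_pairs_le)

end
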